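(* Let $d, s \geq 1$ be integers, let $X$ be a subset of $\mathbb{R}^d$, let $K\subset\mathbb{C}$ be an algebraic number field, and let $\mathcal{O}_K$ be its ring of integers. Let $\mathfrak{p}$ be a nonzero prime ideal of $\mathcal{O}_K$. Suppose $D(X) \subset \mathcal{O}_K$. If there exist $a_1,\ldots, a_s \in \mathcal{O}_K$, pairwise distinct modulo $\mathfrak{p}$, such that (1) for each $i \in \{1,\ldots,s\}$, $a_i \not\equiv 0 \pmod{\mathfrak{p}}$, and (2) for each $\alpha \in D(X)$, there exists $i \in \{1,\ldots,s\}$ such that $\alpha \equiv a_i \pmod{\mathfrak{p}}$, then \[ |X| \leq \binom{d+s}{s}+\binom{d+s-1}{s-1}. \]
   Context: For $X \subset \mathbb{R}^d$, $D(X)=\{\|x-y\|^2 : x,y\in X,\ x\neq y\}$ is the set of squared Euclidean distances between two distinct points of $X$. An algebraic number field $K$ is a finite extension of $\mathbb{Q}$; an embedding into $\mathbb{C}$ is fixed and $K$ is regarded as a subfield of $\mathbb{C}$, so that the real numbers in $D(X)$ and the elements of $K$ both lie in $\mathbb{C}$. $\mathcal{O}_K$ is the ring of all algebraic integers in $K$. *)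

theory Defs
  imports "HOL-Analysis.Analysis" "HOL-Algebra.Algebraic_Closure_Type"
begin

abbreviation complex_ring :: "complex ring" where
  "complex_ring \<equiv> ring_of_type_algebra"

definition number_field :: "complex set \<Rightarrow> bool" where
  "number_field K \<longleftrightarrow> subfield K complex_ring \<and> ring.finite_dimension complex_ring \<rat> K"

definition ring_of_integers :: "complex set \<Rightarrow> complex ring" where
  "ring_of_integers K = complex_ring \<lparr>carrier := {z \<in> K. algebraic_int z}\<rparr>"

definition cong_mod_ideal :: "complex set \<Rightarrow> complex \<Rightarrow> complex \<Rightarrow> bool" where
  "cong_mod_ideal I a b \<longleftrightarrow> a - b \<in> I"

definition squared_distances :: "(real ^ 'n) set \<Rightarrow> real set" where
  "squared_distances S = {(norm (x - y))\<^sup>2 | x y. x \<in> S \<and> y \<in> S \<and> x \<noteq> y}"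

end

theory Submission
  imports Defs "HOL-Library.Function_Algebras" "Jordan_Normal_Form.Determinant"
begin

text \<open>
  For \<open>x \<in> S\<close> consider the polynomial function \<open>F x\<close> with
  \<open>F x y = (\<Prod>i = 1..s. \<parallel>x - y\<parallel>\<^sup>2 - a i)\<close>. For \<open>y \<in> S\<close> its value lies in \<open>P\<close> if and only if
  \<open>y \<noteq> x\<close>, so the determinant of the matrix of values on any finite subset of \<open>S\<close> is not in \<open>P\<close>,
  hence nonzero, and the \<open>F x\<close> are linearly independent over the complex numbers. They all lie in
  the span of the monomials of degree at most \<open>s\<close> and the products \<open>\<parallel>y\<parallel>\<^bsup>2(s - k)\<^esup> y\<^bsup>m\<^esup>\<close> with
  \<open>k = \<bar>m\<bar> < s\<close>, and counting these multi-indices gives the two binomial coefficients.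
\<close>

section \<open>Matrices that are diagonal modulo a prime ideal\<close>

text \<open>Ring and ideal are kept as sets inside an integral domain type, so that sums, products
  and determinants are those of the type class instead of record operations.\<close>

locale subring_with_prime =
  fixes A P :: "'a::idom set"
  assumes one_closed: "1 \<in> A"
    and diff_closed: "x \<in> A \<Longrightarrow> y \<in> A \<Longrightarrow> x - y \<in> A"
    and mult_closed: "x \<in> A \<Longrightarrow> y \<in> A \<Longrightarrow> x * y \<in> A"
    and ideal_subset: "P \<subseteq> A"
    and ideal_zero: "0 \<in> P"
    and ideal_diff: "x \<in> P \<Longrightarrow> y \<in> P \<Longrightarrow> x - y \<in> P"
    and ideal_mult: "x \<in> A \<Longrightarrow> y \<in> P \<Longrightarrow> x * y \<in> P"
    and prime: "x \<in> A \<Longrightarrow> y \<in> A \<Longrightarrow> x * y \<in> P \<Longrightarrow> x \<in> P \<or> y \<in> P"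
    and one_notin: "1 \<notin> P"
begin

lemma ideal_uminus: "x \<in> P \<Longrightarrow> - x \<in> P"
  using ideal_diff[OF ideal_zero] by fastforce

lemma ideal_add: "x \<in> P \<Longrightarrow> y \<in> P \<Longrightarrow> x + y \<in> P"
  using ideal_diff[of x "- y"] ideal_uminus by simp

lemma ideal_sum: "(\<And>i. i \<in> I \<Longrightarrow> f i \<in> P) \<Longrightarrow> sum f I \<in> P"
  by (induction I rule: infinite_finite_induct) (auto simp: ideal_zero ideal_add)

lemma prod_closed: "(\<And>i. i \<in> I \<Longrightarrow> f i \<in> A) \<Longrightarrow> prod f I \<in> A"
  by (induction I rule: infinite_finite_induct) (auto simp: one_closed mult_closed)

lemma ideal_prod:
  assumes "finite I" "i \<in> I" "f i \<in> P" "\<And>j. j \<in> I \<Longrightarrow> f j \<in> A"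
  shows "prod f I \<in> P"
proof -
  have "prod f I = prod f (I - {i}) * f i"
    using assms(1,2) by (simp add: prod.remove mult.commute)
  then show ?thesis
    using assms by (auto intro!: ideal_mult prod_closed)
qed

lemma prod_notin:
  assumes "\<And>i. i \<in> I \<Longrightarrow> f i \<in> A - P"
  shows "prod f I \<notin> P"
  using assms
proof (induction I rule: infinite_finite_induct)
  case (insert i I)
  then have "prod f I \<in> A"
    by (auto intro!: prod_closed)
  with insert show ?case
    using prime[of "f i" "prod f I"] by auto
qed (auto simp: one_notin)

text \<open>In the Leibniz expansion every permutation other than the identity picks an off-diagonal
  entry, so its term lies in \<open>P\<close>; the identity term is a product of elements outside
  the prime ideal.\<close>

lemma det_notin:
  assumes M: "M \<in> carrier_mat n n"
    and diag: "\<And>i. i < n \<Longrightarrow> M $$ (i, i) \<in> A - P"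
    and off: "\<And>i j. i < n \<Longrightarrow> j < n \<Longrightarrow> i \<noteq> j \<Longrightarrow> M $$ (i, j) \<in> P"
  shows "Determinant.det M \<notin> P"
proof
  let ?S = "{p. p permutes {0..<n}}"
  let ?t = "\<lambda>p. signof p * (\<Prod>i = 0..<n. M $$ (i, p i)) :: 'a"
  have "?t p \<in> P" if p: "p \<in> ?S - {id}" for p
  proof -
    have pn: "p i < n" if "i < n" for i
      using p that permutes_in_image[of p "{0..<n}" i] by auto
    from p obtain i where "p i \<noteq> i"
      by fastforce
    moreover from this have "i \<in> {0..<n}"
      using p permutes_not_in[of p "{0..<n}" i] by auto
    moreover have "M $$ (j, p j) \<in> A" if "j < n" for j
      using diag off ideal_subset pn that by (cases "p j = j") fastforce+
    ultimately have "(\<Prod>i = 0..<n. M $$ (i, p i)) \<in> P"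
      using off pn by (intro ideal_prod[of _ i]) auto
    then show ?thesis
      using ideal_uminus by (cases p rule: sign_cases) auto
  qed
  then have "sum ?t (?S - {id}) \<in> P"
    by (rule ideal_sum)
  moreover have "Determinant.det M = ?t id + sum ?t (?S - {id})"
    unfolding det_def'[OF M]
    by (rule sum.remove) (auto simp: finite_permutations permutes_id)
  moreover assume "Determinant.det M \<in> P"
  ultimately have "?t id \<in> P"
    using ideal_diff by fastforce
  moreover have "(\<Prod>i = 0..<n. M $$ (i, i)) \<notin> P"
    by (rule prod_notin) (use diag in auto)
  ultimately show False
    by simp
qed

text \<open>A nontrivial relation would be a kernel vector and force the determinant to be 0, an
  element of \<open>P\<close>. The coefficients \<open>c\<close> may be any elements of the domain,
  not only of \<open>A\<close>.\<close>

lemma coefficients_zero: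
  assumes "finite T"
    and diag: "\<And>x. x \<in> T \<Longrightarrow> F x x \<in> A - P"
    and off: "\<And>x y. x \<in> T \<Longrightarrow> y \<in> T \<Longrightarrow> x \<noteq> y \<Longrightarrow> F x y \<in> P"
    and sum0: "\<And>y. y \<in> T \<Longrightarrow> (\<Sum>x\<in>T. c x * F x y) = 0"
    and "x \<in> T"
  shows "c x = 0"
proof (rule ccontr)
  assume "c x \<noteq> 0"
  obtain h where h: "bij_betw h {0..<card T} T"
    using ex_bij_betw_nat_finite[OF \<open>finite T\<close>] by blast
  then obtain k where k: "k < card T" "h k = x"
    using \<open>x \<in> T\<close> unfolding bij_betw_def by (metis atLeastLessThan_iff imageE)
  define n where "n = card T"
  note h = h[folded n_def] and k = k[folded n_def]
  \<comment> \<open>Rows are evaluation points and columns are functions, so entry \<open>i\<close>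
    of the product with \<open>v\<close> is the relation evaluated at \<open>h i\<close>.\<close>
  define M where "M = mat n n (\<lambda>(i, j). F (h j) (h i))"
  define v where "v = vec n (c \<circ> h)"
  have M: "M \<in> carrier_mat n n" and v: "v \<in> carrier_vec n"
    by (simp_all add: M_def v_def)
  have hT: "h i \<in> T" if "i < n" for i
    using h that by (auto simp: bij_betw_def)
  have hne: "h i \<noteq> h j" if "i < n" "j < n" "i \<noteq> j" for i j
    using h that by (auto simp: bij_betw_def dest: inj_onD)
  have "M *\<^sub>v v = 0\<^sub>v n"
  proof (rule eq_vecI)
    fix i assume i: "i < dim_vec (0\<^sub>v n :: 'a vec)"
    have "vec_index (M *\<^sub>v v) i = (\<Sum>j = 0..<n. c (h j) * F (h j) (h i))"
      using i by (simp add: M_def v_def scalar_prod_def mult.commute)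
    also have "\<dots> = (\<Sum>x\<in>T. c x * F x (h i))"
      by (rule sum.reindex_bij_betw[OF h])
    finally show "vec_index (M *\<^sub>v v) i = vec_index (0\<^sub>v n) i"
      using i hT sum0 by simp
  qed (simp add: M_def)
  moreover have "vec_index v k \<noteq> 0"
    using k \<open>c x \<noteq> 0\<close> by (simp add: v_def)
  then have "v \<noteq> 0\<^sub>v n"
    using k by auto
  ultimately have "Determinant.det M = 0"
    using det_0_iff_vec_prod_zero[OF M] v by blast
  moreover have "Determinant.det M \<notin> P"
    using hT hne diag off by (intro det_notin[OF M]) (auto simp: M_def)
  ultimately show False
    using ideal_zero by simp
qed

end

section \<open>Record-based prime ideals as instances of the locale\<close>

lemma subring_with_prime_if_primeideal:
  fixes A P :: "'a::idom set"
  assumes "primeideal P (ring_of_type_algebra\<lparr>carrier := A\<rparr>)"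
  shows "subring_with_prime A P"
proof -
  let ?R = "ring_of_type_algebra\<lparr>carrier := A\<rparr> :: 'a ring"
  interpret primeideal P ?R by fact
  have carr: "carrier ?R = A"
    by simp
  have add: "x \<oplus>\<^bsub>?R\<^esub> y = x + y" and mult: "x \<otimes>\<^bsub>?R\<^esub> y = x * y"
    and one: "\<one>\<^bsub>?R\<^esub> = 1" and zero: "\<zero>\<^bsub>?R\<^esub> = 0" for x y
    by (simp_all add: ring_of_type_algebra_def)
  note ops = carr add mult one zero
  \<comment> \<open>The additive inverse is not a record field but a description that depends on the
    carrier, so its agreement with \<open>-\<close> has to be derived for elements of
    \<open>A\<close>.\<close>
  have neg: "\<ominus>\<^bsub>?R\<^esub> x = - x" if "x \<in> A" for x
    using r_neg[of x] that unfolding ops by (simp add: eq_neg_iff_add_eq_0 add.commute)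
  have minus: "- x \<in> A" if "x \<in> A" for x
    using a_inv_closed[of x] that neg unfolding ops by simp
  have PA: "P \<subseteq> A"
    using a_subset unfolding ops .
  have negP: "- x \<in> P" if "x \<in> P" for x
    using that neg PA
    by (metis additive_subgroup.a_inv_closed additive_subgroup_axioms subsetD)
  show ?thesis
  proof
    show "x - y \<in> A" if "x \<in> A" "y \<in> A" for x y
      using add.m_closed[of x "- y"] that minus unfolding ops by simp
    show "x - y \<in> P" if "x \<in> P" "y \<in> P" for x y
      using additive_subgroup.a_closed[OF additive_subgroup_axioms that(1) negP[OF that(2)]]
      unfolding ops by simp
    show "0 \<in> P"
      using additive_subgroup.zero_closed[OF additive_subgroup_axioms] unfolding ops .
    show "1 \<notin> P"
      using one_imp_carrier I_notcarr unfolding ops by auto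
  qed (use one_closed m_closed zero_closed I_l_closed I_prime PA in \<open>unfold ops, auto\<close>)
qed

section \<open>A function space spanned by few polynomials\<close>

text \<open>The \<open>a i\<close> may be non-real, so spans of functions on real points are needed
  over the complex numbers; scaling is therefore pointwise multiplication by values of the
  field.\<close>

global_interpretation fun_space:
  vector_space "\<lambda>(c::'b::field) (f::'a \<Rightarrow> 'b) x. c * f x"
  defines fun_span = fun_space.span
  by unfold_locales (auto simp: fun_eq_iff algebra_simps)

lemma fun_span_cmult: "f \<in> fun_span G \<Longrightarrow> (\<lambda>y. c * f y) \<in> fun_span G"
  by (rule fun_space.span_scale)

lemma fun_span_add: "f \<in> fun_span G \<Longrightarrow> g \<in> fun_span G \<Longrightarrow> (\<lambda>y. f y + g y) \<in> fun_span G"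
  using fun_space.span_add[of f G g] by (simp add: plus_fun_def)

lemma fun_span_sum:
  assumes "\<And>i. i \<in> I \<Longrightarrow> f i \<in> fun_span G"
  shows "(\<lambda>y. \<Sum>i\<in>I. f i y) \<in> fun_span G"
proof -
  have "(\<lambda>y. \<Sum>i\<in>I. f i y) = sum f I"
    by (induction I rule: infinite_finite_induct) (auto simp: fun_eq_iff)
  then show ?thesis
    using fun_space.span_sum[of I f G] assms by simp
qed

lemma fun_span_mult:
  assumes "f \<in> fun_span G" and "\<And>g. g \<in> G \<Longrightarrow> (\<lambda>y. h y * g y) \<in> fun_span G'"
  shows "(\<lambda>y. h y * f y) \<in> fun_span G'"
  using assms(1)
proof (induction rule: fun_space.span_induct_alt)
  case base
  show ?case
    using fun_space.span_zero[of G'] by (simp add: zero_fun_def)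
next
  case (step c g f)
  have "(\<lambda>y. c * (h y * g y) + h y * f y) \<in> fun_span G'"
    using step assms(2) by (intro fun_span_add fun_span_cmult)
  then show ?case
    by (simp add: algebra_simps)
qed

section \<open>Spanning polynomials and how multiplication acts on them\<close>

definition sqnorm :: "real ^ 'n \<Rightarrow> complex" where
  "sqnorm y = (\<Sum>i\<in>UNIV. of_real (vec_nth y i) ^ 2)"

definition monomial :: "('n \<Rightarrow> nat) \<Rightarrow> real ^ 'n \<Rightarrow> complex" where
  "monomial m y = (\<Prod>i\<in>UNIV. of_real (vec_nth y i) ^ m i)"

lemma monomial_zero: "monomial (\<lambda>_. 0) y = 1"
  by (simp add: monomial_def)

lemma monomial_upd: "monomial (m(i := m i + k)) y = of_real (vec_nth y i) ^ k * monomial m y"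
proof -
  have "monomial (m(i := m i + k)) y
      = of_real (vec_nth y i) ^ (m i + k) * (\<Prod>j\<in>UNIV - {i}. of_real (vec_nth y j) ^ m j)"
    unfolding monomial_def by (subst prod.remove[of _ i]) auto
  also have "\<dots> = of_real (vec_nth y i) ^ k * monomial m y"
    unfolding monomial_def by (subst (2) prod.remove[of _ i]) (auto simp: power_add)
  finally show ?thesis .
qed

lemma sum_upd_add: "sum (m(i := m i + k :: nat)) (UNIV :: 'n::finite set) = sum m UNIV + k"
  by (simp add: sum.remove[of UNIV i])

text \<open>A monomial of degree k = |m| in the second family gets the power of
  \<open>sqnorm\<close> that makes the total degree 2s - k. For s = 0 truncated subtraction leaves
  only the constant 1 in both families, which is the start of the later induction.\<close>

definition generators :: "nat \<Rightarrow> (real ^ 'n \<Rightarrow> complex) set" where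
  "generators s = monomial ` {m. sum m UNIV \<le> s} \<union>
     (\<lambda>m y. sqnorm y ^ (s - sum m UNIV) * monomial m y) ` {m. sum m UNIV \<le> s - 1}"

lemma monomial_in_span: "sum m UNIV \<le> s \<Longrightarrow> monomial m \<in> fun_span (generators s)"
  by (auto intro!: fun_space.span_base simp: generators_def)

lemma sqnorm_monomial_in_span:
  assumes "sum m UNIV \<le> s" and k: "k = s - sum m UNIV"
  shows "(\<lambda>y. sqnorm y ^ k * monomial m y) \<in> fun_span (generators s)"
proof (cases "sum m UNIV = s")
  case True
  then show ?thesis
    using monomial_in_span[of m s] k by simp
next
  case False
  with assms show ?thesis
    by (auto intro!: fun_space.span_base simp: generators_def)
qed

lemma span_generators_cases:
  assumes "f \<in> fun_span (generators s)"
    and "\<And>m. sum m UNIV \<le> s \<Longrightarrow> (\<lambda>y. h y * monomial m y) \<in> fun_span G'"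
    and "\<And>m. sum m UNIV \<le> s - 1 \<Longrightarrow>
      (\<lambda>y. h y * (sqnorm y ^ (s - sum m UNIV) * monomial m y)) \<in> fun_span G'"
  shows "(\<lambda>y. h y * f y) \<in> fun_span G'"
  using assms(1) by (rule fun_span_mult) (use assms(2,3) in \<open>auto simp: generators_def\<close>)

lemma sqnorm_mult_monomial:
  "sqnorm y * monomial m y = (\<Sum>i\<in>UNIV. monomial (m(i := m i + 2)) y)"
  by (simp only: sqnorm_def monomial_upd sum_distrib_right)

text \<open>Raising one exponent increases |m| by 1 together with s, so the power s - |m| of
  \<open>sqnorm\<close> stays the same.\<close>

lemma coordinate_mult_span:
  assumes "f \<in> fun_span (generators s)"
  shows "(\<lambda>y. of_real (vec_nth y i) * f y) \<in> fun_span (generators (Suc s))"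
proof -
  have eq: "of_real (vec_nth y i) * monomial m y = monomial (m(i := m i + 1)) y" for m y
    by (simp only: monomial_upd power_one_right)
  show ?thesis
  proof (rule span_generators_cases[OF assms])
    fix m :: "'a \<Rightarrow> nat"
    assume "sum m UNIV \<le> s"
    then show "(\<lambda>y. of_real (vec_nth y i) * monomial m y) \<in> fun_span (generators (Suc s))"
      unfolding eq by (intro monomial_in_span) (simp only: sum_upd_add)
  next
    fix m :: "'a \<Rightarrow> nat"
    assume "sum m UNIV \<le> s - 1"
    then have "(\<lambda>y. sqnorm y ^ (s - sum m UNIV) * monomial (m(i := m i + 1)) y)
        \<in> fun_span (generators (Suc s))"
      by (intro sqnorm_monomial_in_span) ((simp only: sum_upd_add; simp)+)
    then show "(\<lambda>y. of_real (vec_nth y i) * (sqnorm y ^ (s - sum m UNIV) * monomial m y))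
        \<in> fun_span (generators (Suc s))"
      by (simp only: eq[symmetric] mult.left_commute)
  qed
qed

text \<open>Generators of the second family keep m and gain a factor \<open>sqnorm\<close>, as s + 1
  requires. A monomial of degree s turns into a new generator of that kind, while one of lower
  degree expands into monomials of degree at most s + 1.\<close>

lemma sqnorm_mult_span:
  assumes "f \<in> fun_span (generators s)"
  shows "(\<lambda>y. sqnorm y * f y) \<in> fun_span (generators (Suc s))"
proof (rule span_generators_cases[OF assms])
  fix m :: "'a \<Rightarrow> nat"
  assume m: "sum m UNIV \<le> s"
  show "(\<lambda>y. sqnorm y * monomial m y) \<in> fun_span (generators (Suc s))"
  proof (cases "sum m UNIV = s")
    case True
    then show ?thesis
      using sqnorm_monomial_in_span[of m "Suc s" 1] by simp
  next
    case False
    with m show ?thesis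
      unfolding sqnorm_mult_monomial
      by (intro fun_span_sum monomial_in_span) (simp only: sum_upd_add)
  qed
next
  fix m :: "'a \<Rightarrow> nat"
  assume "sum m UNIV \<le> s - 1"
  then have "(\<lambda>y. sqnorm y ^ (Suc (s - sum m UNIV)) * monomial m y)
      \<in> fun_span (generators (Suc s))"
    by (intro sqnorm_monomial_in_span) auto
  then show "(\<lambda>y. sqnorm y * (sqnorm y ^ (s - sum m UNIV) * monomial m y))
      \<in> fun_span (generators (Suc s))"
    by (simp add: mult.assoc)
qed

text \<open>
  Passing from \<open>s\<close> to \<open>s + 1\<close> would demand one more factor \<open>\<parallel>y\<parallel>\<^sup>2\<close> in each generator; instead one
  such factor is traded for the sum of the \<open>y\<^sub>i\<^sup>2\<close>, which raises \<open>\<bar>m\<bar>\<close> by 2.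
\<close>

lemma span_generators_Suc:
  assumes "f \<in> fun_span (generators s)"
  shows "f \<in> fun_span (generators (Suc s))"
proof -
  have "(\<lambda>y. 1 * f y) \<in> fun_span (generators (Suc s))"
  proof (rule span_generators_cases[OF assms])
    fix m :: "'a \<Rightarrow> nat"
    assume "sum m UNIV \<le> s"
    then show "(\<lambda>y. 1 * monomial m y) \<in> fun_span (generators (Suc s))"
      using monomial_in_span[of m "Suc s"] by simp
  next
    fix m :: "'a \<Rightarrow> nat"
    assume m: "sum m UNIV \<le> s - 1"
    show "(\<lambda>y. 1 * (sqnorm y ^ (s - sum m UNIV) * monomial m y)) \<in> fun_span (generators (Suc s))"
    proof (cases "s = 0")
      case True
      with m show ?thesis
        using monomial_in_span[of m "Suc s"] by simp
    next
      case False
      define k where "k = s - 1 - sum m UNIV"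
      have k: "s - sum m UNIV = Suc k"
        using False m by (simp add: k_def)
      have "(\<lambda>y. \<Sum>i\<in>UNIV. sqnorm y ^ k * monomial (m(i := m i + 2)) y)
          \<in> fun_span (generators (Suc s))"
        using m k False
        by (intro fun_span_sum sqnorm_monomial_in_span) ((simp only: sum_upd_add; simp)+)
      then show ?thesis
        by (simp only: k power_Suc2 mult.assoc sqnorm_mult_monomial sum_distrib_left mult_1)
    qed
  qed
  then show ?thesis
    by simp
qed

section \<open>Counting multi-indices and generators\<close>

lemma card_multi_indices:
  "finite {m :: 'n::finite \<Rightarrow> nat. sum m UNIV \<le> s} \<and>
   card {m :: 'n \<Rightarrow> nat. sum m UNIV \<le> s} \<le> (CARD('n) + s) choose s"
proof -
  let ?L = "{l :: nat list. length l = CARD('n) + 1 \<and> sum_list l = s}"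
  obtain xs :: "'n list" where xs: "set xs = UNIV" "distinct xs"
    using finite_distinct_list[of "UNIV :: 'n set"] by auto
  then have len: "length xs = CARD('n)"
    by (metis distinct_card)
  \<comment> \<open>Stars and bars: the slack s - |m| becomes an extra first entry, so the bound |m|
    \<le> s turns into an exact sum s over \<open>CARD('n) + 1\<close> entries.\<close>
  define enc where "enc m = (s - sum m UNIV) # map m xs" for m :: "'n \<Rightarrow> nat"
  have "inj enc"
    using xs by (auto simp: inj_def enc_def fun_eq_iff map_eq_conv)
  moreover have "enc ` {m. sum m UNIV \<le> s} \<subseteq> ?L"
    using xs len by (auto simp: enc_def sum_list_distinct_conv_sum_set)
  moreover have "?L \<subseteq> {l. set l \<subseteq> {..s} \<and> length l = CARD('n) + 1}"
    using member_le_sum_list by fastforce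
  then have "finite ?L"
    using finite_lists_length_eq finite_subset by blast
  moreover have "card ?L = (CARD('n) + s) choose s"
    unfolding card_length_sum_list by (simp add: add.commute)
  ultimately show ?thesis
    by (metis (no_types, lifting) card_image card_mono finite_imageD finite_subset inj_on_subset
        subset_UNIV)
qed

lemma card_generators:
  assumes "s \<ge> 1"
  shows "finite (generators s :: (real ^ 'n \<Rightarrow> complex) set)"
    and "card (generators s :: (real ^ 'n \<Rightarrow> complex) set)
      \<le> ((CARD('n) + s) choose s) + ((CARD('n) + s - 1) choose (s - 1))"
proof -
  let ?I = "\<lambda>s. {m :: 'n \<Rightarrow> nat. sum m UNIV \<le> s}"
  note I = card_multi_indices[where 'n = 'n]
  show "finite (generators s :: (real ^ 'n \<Rightarrow> complex) set)"
    unfolding generators_def using I by blast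
  have "card (generators s :: (real ^ 'n \<Rightarrow> complex) set) \<le> card (?I s) + card (?I (s - 1))"
    unfolding generators_def
    by (intro order.trans[OF card_Un_le] add_mono card_image_le) (use I in blast)+
  also have "\<dots> \<le> ((CARD('n) + s) choose s) + ((CARD('n) + (s - 1)) choose (s - 1))"
    using I by (intro add_mono) blast+
  finally show "card (generators s :: (real ^ 'n \<Rightarrow> complex) set)
      \<le> ((CARD('n) + s) choose s) + ((CARD('n) + s - 1) choose (s - 1))"
    using assms by simp
qed

section \<open>Expansion of the distance polynomials\<close>

lemma sq_dist_expand:
  "complex_of_real ((norm (x - y))\<^sup>2)
    = sqnorm x + (sqnorm y + (\<Sum>i\<in>UNIV. (- 2 * of_real (vec_nth x i)) * of_real (vec_nth y i)))"
proof -
  have "(norm (x - y))\<^sup>2 = (\<Sum>i\<in>UNIV. (vec_nth x i - vec_nth y i)\<^sup>2)"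
    unfolding power2_norm_eq_inner inner_vec_def by (simp add: power2_eq_square)
  also have "\<dots> = (\<Sum>i\<in>UNIV. (vec_nth x i)\<^sup>2) + ((\<Sum>i\<in>UNIV. (vec_nth y i)\<^sup>2)
      + (\<Sum>i\<in>UNIV. (- 2 * vec_nth x i) * vec_nth y i))"
    by (simp add: sum.distrib[symmetric] power2_diff algebra_simps)
  finally show ?thesis
    by (simp add: sqnorm_def)
qed

text \<open>As a function of y, each factor is a constant plus \<open>sqnorm y\<close> plus a linear
  form. Multiplication by any of these three takes the span for s into the span for s + 1.\<close>

lemma distance_poly_in_span:
  "(\<lambda>y. \<Prod>i\<in>{1..s}. (complex_of_real ((norm (x - y))\<^sup>2) - a i)) \<in> fun_span (generators s)"
proof (induction s)
  case 0
  show ?case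
    using monomial_in_span[of "\<lambda>_. 0" 0] by (simp add: monomial_zero[abs_def])
next
  case (Suc s)
  let ?f = "\<lambda>y. \<Prod>i\<in>{1..s}. (complex_of_real ((norm (x - y))\<^sup>2) - a i)"
  have "(\<lambda>y. (sqnorm x - a (Suc s)) * ?f y + (sqnorm y * ?f y
      + (\<Sum>i\<in>UNIV. (- 2 * of_real (vec_nth x i)) * (of_real (vec_nth y i) * ?f y))))
      \<in> fun_span (generators (Suc s))"
    by (intro fun_span_add fun_span_cmult fun_span_sum sqnorm_mult_span coordinate_mult_span
        span_generators_Suc Suc.IH)
  also have "(\<lambda>y. (sqnorm x - a (Suc s)) * ?f y + (sqnorm y * ?f y
      + (\<Sum>i\<in>UNIV. (- 2 * of_real (vec_nth x i)) * (of_real (vec_nth y i) * ?f y))))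
      = (\<lambda>y. (complex_of_real ((norm (x - y))\<^sup>2) - a (Suc s)) * ?f y)"
  proof
    fix y
    have "(p - q) * g + (r * g + t * g) = (p + (r + t) - q) * g" for p q r t g :: complex
      by (simp add: left_diff_distrib distrib_right)
    then show "(sqnorm x - a (Suc s)) * ?f y + (sqnorm y * ?f y
        + (\<Sum>i\<in>UNIV. (- 2 * of_real (vec_nth x i)) * (of_real (vec_nth y i) * ?f y)))
        = (complex_of_real ((norm (x - y))\<^sup>2) - a (Suc s)) * ?f y"
      unfolding mult.assoc[symmetric] sum_distrib_right[symmetric] sq_dist_expand .
  qed
  finally show ?case
    by (simp add: mult.commute)
qed

section \<open>Independence of the distance polynomials and the bound on the set\<close>

theorem corollary3p2:
  fixes S :: "(real ^ 'n) set" and K :: "complex set" and P :: "complex set"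
    and a :: "nat \<Rightarrow> complex" and s :: nat
  assumes "s \<ge> 1"
    and "number_field K"
    and "primeideal P (ring_of_integers K)"
    and "P \<noteq> {0}"
    and "complex_of_real ` squared_distances S \<subseteq> carrier (ring_of_integers K)"
    and "\<And>i. i \<in> {1..s} \<Longrightarrow> a i \<in> carrier (ring_of_integers K)"
    and "\<And>i j. i \<in> {1..s} \<Longrightarrow> j \<in> {1..s} \<Longrightarrow> i \<noteq> j \<Longrightarrow> \<not> cong_mod_ideal P (a i) (a j)"
    and "\<And>i. i \<in> {1..s} \<Longrightarrow> \<not> cong_mod_ideal P (a i) 0"
    and "\<And>\<alpha>. \<alpha> \<in> squared_distances S \<Longrightarrow>
           \<exists>i \<in> {1..s}. cong_mod_ideal P (complex_of_real \<alpha>) (a i)"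
  shows "finite S \<and>
    card S \<le> ((CARD('n) + s) choose s) + ((CARD('n) + s - 1) choose (s - 1))"
proof -
  define A where "A = carrier (ring_of_integers K)"
  have "ring_of_integers K = complex_ring\<lparr>carrier := A\<rparr>"
    by (simp add: A_def ring_of_integers_def)
  then interpret subring_with_prime A P
    using assms(3) subring_with_prime_if_primeideal by metis
  define F where "F x y = (\<Prod>i\<in>{1..s}. (complex_of_real ((norm (x - y))\<^sup>2) - a i))"
    for x y :: "real ^ 'n"
  have aA: "a i \<in> A" "a i \<notin> P" if "i \<in> {1..s}" for i
    using assms(6,8) that by (auto simp: A_def cong_mod_ideal_def)
  \<comment> \<open>The distance from x to itself is 0, so every factor is \<open>0 - a i\<close>,
    which lies outside \<open>P\<close> by condition (1).\<close>
  have diag: "F x x \<in> A - P" for x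
  proof -
    have "0 - a i \<in> A - P" if "i \<in> {1..s}" for i
      using aA[OF that] ideal_uminus[of "- a i"] ideal_zero ideal_subset diff_closed by fastforce
    then show ?thesis
      using prod_notin[of "{1..s}" "\<lambda>i. 0 - a i"] prod_closed[of "{1..s}" "\<lambda>i. 0 - a i"]
      by (simp add: F_def)
  qed
  \<comment> \<open>Condition (2) puts one factor into \<open>P\<close>; the others only have to lie
    in \<open>A\<close>.\<close>
  have off: "F x y \<in> P" if "x \<in> S" "y \<in> S" "x \<noteq> y" for x y
  proof -
    have D: "(norm (x - y))\<^sup>2 \<in> squared_distances S"
      using that by (auto simp: squared_distances_def)
    then obtain i where "i \<in> {1..s}" "complex_of_real ((norm (x - y))\<^sup>2) - a i \<in> P"
      using assms(9)[OF D] unfolding cong_mod_ideal_def by blast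
    moreover have "complex_of_real ((norm (x - y))\<^sup>2) - a j \<in> A" if "j \<in> {1..s}" for j
      using D assms(5) aA[OF that] by (intro diff_closed) (auto simp: A_def)
    ultimately show ?thesis
      unfolding F_def by (intro ideal_prod[of _ i]) auto
  qed
  \<comment> \<open>If \<open>F x = F y\<close> for distinct points, then
    \<open>F x y = F y y\<close> would lie both inside and outside \<open>P\<close>.\<close>
  have inj: "inj_on F S"
    using diag off by (metis DiffD2 inj_onI)
  have "fun_space.independent (F ` S)"
    unfolding fun_space.independent_explicit_module
  proof (intro allI impI)
    fix t u f
    assume t: "finite t" "t \<subseteq> F ` S" "(\<Sum>v\<in>t. (\<lambda>x. u v * v x)) = 0" "f \<in> t"
    then obtain T where T: "T \<subseteq> S" "t = F ` T"
      by (meson subset_imageE)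
    have injT: "inj_on F T"
      using inj T(1) inj_on_subset by blast
    then have "finite T"
      using t(1) T(2) finite_imageD by blast
    obtain x where x: "x \<in> T" "f = F x"
      using t(4) T(2) by blast
    have app: "(\<Sum>v\<in>I. (\<lambda>x. u v * v x)) y = (\<Sum>v\<in>I. u v * v y)" for I y
      by (induction I rule: infinite_finite_induct) auto
    have "(\<Sum>x\<in>T. u (F x) * F x y) = 0" for y
      using arg_cong[OF t(3), of "\<lambda>g. g y"] injT
      unfolding app T(2) by (simp add: sum.reindex)
    moreover have "F x y \<in> P" if "x \<in> T" "y \<in> T" "x \<noteq> y" for x y
      using off that T(1) by blast
    ultimately show "u f = 0"
      unfolding x(2) using x(1) \<open>finite T\<close> diag
      by (intro coefficients_zero[of T F "\<lambda>x. u (F x)"])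
  qed
  moreover have "F ` S \<subseteq> fun_span (generators s)"
    using distance_poly_in_span by (auto simp: F_def[abs_def])
  \<comment> \<open>An independent set in the span of finitely many functions is finite, so
    finiteness of \<open>S\<close> is a conclusion here, carried back along the injective
    \<open>F\<close>.\<close>
  ultimately have "finite (F ` S) \<and> card (F ` S) \<le> card (generators s :: (real ^ 'n \<Rightarrow> complex) set)"
    by (intro fun_space.independent_span_bound card_generators(1)[OF assms(1)])
  then show ?thesis
    using card_generators(2)[OF assms(1), where 'n = 'n] inj
    by (auto simp: card_image dest: finite_imageD)
qed

end
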